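(* Let $T\ge1$ and $\varepsilon>0$. Suppose that, for each $t$, $f_t:Q\to\mathbb{R}$ is $M_t$-relatively Lipschitz-continuous and $\mu_t$-strongly convex with respect to the prox-function $h$. Let $g:Q\to\mathbb{R}$ be $M_g$-relatively Lipschitz-continuous and $\mu_g$-strongly convex with respect to $h$. Let $d:Q\to\mathbb{R}$ be $M_d$-relatively Lipschitz-continuous and $1$-strongly convex with respect to $h$, with $d(x)\ge 0$ for all $x\in Q$. Put $A^2=\sup_{x\in Q}d(x)$ and $M=\max\{M_g,\max_tM_t\}$. If the regularized switching Mirror Descent algorithm described in the context makes exactly $T$ productive steps (and then stops) and $\mathrm{Regret}_T\ge 0$, then $$\mathrm{Regret}_T\le\lambda_{1:T+T_J}A^2+\sum_{t=1}^{T+T_J}\frac{(M+\lambda_tM_d)^2}{\mu_{1:t}+\lambda_{1:t}}-\varepsilon T_J,$$ and $$\mathrm{Regret}_T\le 2\inf_{\lambda_1^*,\dots,\lambda_{T+T_J}^*}\left((A^2+2M_d^2)\lambda_{1:T+T_J}^*+\sum_{t=1}^{T+T_J}\frac{(M+\lambda_t^*M_d)^2}{\mu_{1:t}+\lambda_{1:t}^*}\right)-\varepsilon T_J,$$ where $T_J$ is the number of non-productive steps, the infimum is over $\lambda_1^*,\dots,\lambda_{T+T_J}^*\ge 0$ (with all denominators positive), and $g(x_t)\le\varepsilon$ for every productive step $t\in I$.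
   Context: $Q\subset\mathbb{R}^n$ is a closed convex set, and $h$ is a convex, continuously differentiable function on $Q$ (prox-function). Its Bregman divergence is $V(y,x)=h(y)-h(x)-\langle\nabla h(x),y-x\rangle$. For a convex function $f$, $\nabla f(x)$ denotes its (sub)gradient at $x$ (the one used by the algorithm). A convex function $f:Q\to\mathbb{R}$ is $M$-relatively Lipschitz-continuous (with respect to $h$), $M>0$, if $\langle\nabla f(x),y-x\rangle+M\sqrt{2V(y,x)}\ge 0$ for all $x,y\in Q$. A function $f$ is $\mu$-strongly convex with respect to $h$ if $f(x)\ge f(y)+\langle\nabla f(y),x-y\rangle+\mu V(x,y)$ for all $x,y\in Q$. Notation: $\mu_{1:t}=\sum_{s=1}^t\mu_s$, $\lambda_{1:t}=\sum_{s=1}^t\lambda_s$, $\lambda^*_{1:t}=\sum_{s=1}^t\lambda^*_s$, and $\mu_{1:0}=\lambda_{1:0}=0$. Here $\mu_s$ is the strong convexity parameter of $f_s$ if step $s$ is productive, and $\mu_s=\mu_g$ if step $s$ is non-productive. It is assumed that $\mu_s\ge 0$ and $A^2<\infty$. Algorithm. Given $\varepsilon>0$, $T$ and $x_1\in Q$, at iteration $t=1,2,\dots$: step $t$ is "productive" if $g(x_t)\le\varepsilon$ and "non-productive" otherwise. Put $$\lambda_t=\tfrac12\left(\sqrt{(\mu_{1:t}+\lambda_{1:t-1})^2+\frac{8M^2}{A^2+2M_d^2}}-(\mu_{1:t}+\lambda_{1:t-1})\right),\qquad \eta_t=\frac{1}{\mu_{1:t}+\lambda_{1:t}}.$$ Let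 $p_t=\nabla f_t(x_t)+\lambda_t\nabla d(x_t)$ if step $t$ is productive and $p_t=\nabla g(x_t)+\lambda_t\nabla d(x_t)$ if it is non-productive, and perform the Mirror Descent step $$x_{t+1}=\arg\min_{x\in Q}\{\eta_t\langle p_t,x\rangle+V(x,x_t)\}$$ (the minimizer is assumed to exist). Stop as soon as $T$ productive steps have been made. $I$ and $J$ denote the sets of indices of productive and non-productive steps, $|I|=T$ and $|J|=T_J$, so that $t$ runs over $1,\dots,T+T_J$. The loss $f_t$ is used only when $t\in I$. The regret is $$\mathrm{Regret}_T=\sum_{t\in I}f_t(x_t)-\min_{x\in Q,\ g(x)\le 0}\ \sum_{t\in I}f_t(x),$$ where the minimum is assumed to be attained at some $x^*\in Q$ with $g(x^* )\le 0$. *)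

theory Defs
  imports "HOL-Analysis.Analysis"
begin

(* The gradient is passed explicitly: on a set Q with empty interior it is not determined
   by the values of h on Q.  Derivatives are taken within Q. *)
definition prox_function :: "(real ^ 'n) set \<Rightarrow> (real ^ 'n \<Rightarrow> real) \<Rightarrow> (real ^ 'n \<Rightarrow> real ^ 'n) \<Rightarrow> bool" where
  "prox_function Q h gh \<longleftrightarrow>
     convex_on Q h \<and>
     (\<forall>x\<in>Q. (h has_derivative (\<lambda>v. gh x \<bullet> v)) (at x within Q)) \<and>
     continuous_on Q gh"

definition bregman :: "(real ^ 'n \<Rightarrow> real) \<Rightarrow> (real ^ 'n \<Rightarrow> real ^ 'n) \<Rightarrow> real ^ 'n \<Rightarrow> real ^ 'n \<Rightarrow> real" where
  "bregman h gh y x = h y - h x - gh x \<bullet> (y - x)"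

(* gf selects, at each point of Q, the subgradient of f that the algorithm uses. *)
definition subgradient_selection :: "(real ^ 'n) set \<Rightarrow> (real ^ 'n \<Rightarrow> real) \<Rightarrow> (real ^ 'n \<Rightarrow> real ^ 'n) \<Rightarrow> bool" where
  "subgradient_selection Q f gf \<longleftrightarrow> (\<forall>x\<in>Q. \<forall>y\<in>Q. f y \<ge> f x + gf x \<bullet> (y - x))"

definition rel_lipschitz ::
  "(real ^ 'n) set \<Rightarrow> (real ^ 'n \<Rightarrow> real) \<Rightarrow> (real ^ 'n \<Rightarrow> real ^ 'n) \<Rightarrow> real
    \<Rightarrow> (real ^ 'n \<Rightarrow> real) \<Rightarrow> (real ^ 'n \<Rightarrow> real ^ 'n) \<Rightarrow> bool" where
  "rel_lipschitz Q h gh M f gf \<longleftrightarrow>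
     M > 0 \<and> convex_on Q f \<and> subgradient_selection Q f gf \<and>
     (\<forall>x\<in>Q. \<forall>y\<in>Q. gf x \<bullet> (y - x) + M * sqrt (2 * bregman h gh y x) \<ge> 0)"

definition rel_strongly_convex ::
  "(real ^ 'n) set \<Rightarrow> (real ^ 'n \<Rightarrow> real) \<Rightarrow> (real ^ 'n \<Rightarrow> real ^ 'n) \<Rightarrow> real
    \<Rightarrow> (real ^ 'n \<Rightarrow> real) \<Rightarrow> (real ^ 'n \<Rightarrow> real ^ 'n) \<Rightarrow> bool" where
  "rel_strongly_convex Q h gh \<mu> f gf \<longleftrightarrow>
     (\<forall>x\<in>Q. \<forall>y\<in>Q. f x \<ge> f y + gf y \<bullet> (x - y) + \<mu> * bregman h gh x y)"

(* The infimum of reals is meaningful only when it is attained (or at least when the set of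
   values is nonempty and bounded below). *)
definition regret ::
  "(real ^ 'n) set \<Rightarrow> (real ^ 'n \<Rightarrow> real) \<Rightarrow> (nat \<Rightarrow> real ^ 'n \<Rightarrow> real) \<Rightarrow> nat set
    \<Rightarrow> (nat \<Rightarrow> real ^ 'n) \<Rightarrow> real" where
  "regret Q g f I x =
     (\<Sum>t\<in>I. f t (x t)) - (INF z\<in>{z \<in> Q. g z \<le> 0}. \<Sum>t\<in>I. f t z)"

end

theory Submission
  imports Defs
begin

text \<open>
  With $S_t = \mu_{1:t} + \lambda_{1:t}$, strong convexity turns the mirror descent inequality for step
  $t$ into $S_{t-1} V(x^*, x_t) - S_t V(x^*, x_{t+1})$ plus $\lambda_t (d(x^*) - d(x_t))$ plus
  $(M + \lambda_t M_d)^2 / (2 S_t)$, and the divergences telescope.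

  For the second bound, estimating $d(x^*) - d(x_t)$ by $A^2$ does not give the constant $2$. Instead one
  uses that a relatively Lipschitz and relatively $1$-strongly convex function oscillates by at most
  $M_d^2 / 2$. Put $B = A^2 + 2 M_d^2$. The rule for $\lambda_t$ says $\lambda_t S_t = 2 M^2 / B$, so that
  step $t$ costs at most $B \lambda_t (3/4 + \lambda_t / (2 S_t))$. These costs are compared with those of
  arbitrary $\lambda^*$ by induction: if $\lambda_{1:t} \le \lambda^*_{1:t}$, the linear terms suffice;
  otherwise $S_t > \mu_{1:t} + \lambda^*_{1:t}$ and the quotients of the last step suffice.
\<close>

text \<open>Since \<open>Q\<close> may have empty interior, only derivatives within \<open>Q\<close>
  are available. Along the segment from \<open>x\<close> to \<open>y\<close>, which convexity keeps
  in \<open>Q\<close>, the difference quotients at 0 are at most \<open>c\<close>, hence so is their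
  one-sided limit.\<close>

lemma directional_derivative_le:
  fixes F :: "'a::real_normed_vector \<Rightarrow> real"
  assumes Q: "convex Q" "x \<in> Q" "y \<in> Q"
    and F: "(F has_derivative F') (at x within Q)"
    and le: "\<And>t. 0 < t \<Longrightarrow> t \<le> 1 \<Longrightarrow> F (x + t *\<^sub>R (y - x)) - F x \<le> t * c"
  shows "F' (y - x) \<le> c"
proof -
  define u where "u = (\<lambda>t. x + t *\<^sub>R (y - x))"
  have uQ: "u ` {0..1} \<subseteq> Q"
  proof
    fix w assume "w \<in> u ` {0..1}"
    then obtain t where "0 \<le> t" "t \<le> 1" "w = (1 - t) *\<^sub>R x + t *\<^sub>R y"
      by (auto simp: u_def algebra_simps)
    then show "w \<in> Q"
      using convexD_alt[OF Q] by simp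
  qed
  have "(u has_derivative (\<lambda>t. t *\<^sub>R (y - x))) (at 0 within {0..1})"
    unfolding u_def by (auto intro!: derivative_eq_intros)
  moreover have "(F has_derivative F') (at (u 0) within u ` {0..1})"
    using F uQ by (auto simp: u_def intro: has_derivative_subset)
  ultimately have "((\<lambda>t. F (u t)) has_derivative (\<lambda>t. F' (t *\<^sub>R (y - x)))) (at 0 within {0..1})"
    by (rule has_derivative_in_compose)
  moreover have "F' (t *\<^sub>R (y - x)) = t * F' (y - x)" for t
    using linear_scale[OF has_derivative_linear[OF F]] by simp
  ultimately have "((\<lambda>t. F (u t)) has_real_derivative F' (y - x)) (at 0 within {0..1})"
    by (simp add: has_field_derivative_def mult_commute_abs)
  then have lim: "((\<lambda>t. (F (u t) - F (u 0)) / (t - 0)) \<longlongrightarrow> F' (y - x)) (at 0 within {0..1})"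
    by (simp add: has_field_derivative_iff)
  have "eventually (\<lambda>t. (F (u t) - F (u 0)) / (t - 0) \<le> c) (at 0 within {0..1})"
    unfolding eventually_at_filter
  proof (intro always_eventually allI impI)
    fix t :: real assume "t \<noteq> 0" "t \<in> {0..1}"
    then show "(F (u t) - F (u 0)) / (t - 0) \<le> c"
      using le[of t] by (simp add: u_def pos_divide_le_eq mult.commute)
  qed
  moreover have "at (0::real) within {0..1} \<noteq> bot"
    by (simp add: trivial_limit_within islimpt_Icc)
  ultimately show ?thesis
    using tendsto_upperbound[OF lim] by blast
qed

text \<open>Convexity bounds the difference quotients of \<open>h\<close> along the segment by
  \<open>h y - h x\<close>; the gradient inequality is their limit.\<close>

lemma bregman_nonneg:
  assumes Q: "convex Q" and h: "prox_function Q h gh" and "x \<in> Q" "y \<in> Q"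
  shows "0 \<le> bregman h gh y x"
proof -
  have "h (x + t *\<^sub>R (y - x)) - h x \<le> t * (h y - h x)" if "0 < t" "t \<le> 1" for t
    using convex_onD[of Q h t x y] h that assms(3,4)
    by (auto simp: prox_function_def algebra_simps)
  then have "gh x \<bullet> (y - x) \<le> h y - h x"
    using directional_derivative_le[OF Q assms(3,4), of h "\<lambda>v. gh x \<bullet> v"] h assms(3)
    by (auto simp: prox_function_def)
  then show ?thesis
    by (simp add: bregman_def)
qed

lemma bregman_three_points:
  "(gh b - gh a) \<bullet> (z - b) = bregman h gh z a - bregman h gh z b - bregman h gh b a"
  by (simp add: bregman_def algebra_simps)

text \<open>The objective has nonnegative derivative at its minimizer \<open>x'\<close> in every
  direction \<open>z - x'\<close> that stays in \<open>Q\<close>; the three-point identity rewrites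
  the gradient term of \<open>h\<close>.\<close>

lemma mirror_step_optimality:
  assumes Q: "convex Q" and h: "prox_function Q h gh"
    and min: "is_arg_min (\<lambda>y. \<eta> * (p \<bullet> y) + bregman h gh y x) (\<lambda>y. y \<in> Q) x'"
    and z: "z \<in> Q"
  shows "\<eta> * (p \<bullet> (x' - z))
           \<le> bregman h gh z x - bregman h gh z x' - bregman h gh x' x"
proof -
  define G where "G = (\<lambda>y. \<eta> * (p \<bullet> y) + bregman h gh y x)"
  have x': "x' \<in> Q" and le: "\<And>y. y \<in> Q \<Longrightarrow> G x' \<le> G y"
    using min by (force simp: is_arg_min_def G_def)+
  \<comment> \<open>Minimality bounds increments of \<open>G\<close> from below, so the upper bound
    on directional derivatives is applied to the negative of \<open>G\<close>.\<close>
  have "((\<lambda>y. - G y) has_derivative (\<lambda>v. - (\<eta> * (p \<bullet> v) + (gh x' \<bullet> v - gh x \<bullet> v)))) (at x' within Q)"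
    using h x' unfolding G_def bregman_def prox_function_def
    by (auto intro!: derivative_eq_intros)
  moreover have "- G (x' + t *\<^sub>R (z - x')) - (- G x') \<le> t * 0" if "0 < t" "t \<le> 1" for t
  proof -
    have "x' + t *\<^sub>R (z - x') \<in> Q"
      using convexD_alt[OF Q x' z, of t] that by (simp add: algebra_simps)
    then show ?thesis
      using le by simp
  qed
  ultimately have "- (\<eta> * (p \<bullet> (z - x')) + (gh x' \<bullet> (z - x') - gh x \<bullet> (z - x'))) \<le> 0"
    by (rule directional_derivative_le[OF Q x' z])
  then have "\<eta> * (p \<bullet> (x' - z)) \<le> (gh x' - gh x) \<bullet> (z - x')"
    by (simp add: algebra_simps)
  then show ?thesis
    by (simp add: bregman_three_points[where h = h])
qed

text \<open>Gives all losses and \<open>g\<close> the common constant \<open>M\<close>. Nonnegative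
  divergence matters here: \<open>sqrt\<close> of a negative real is negative in HOL.\<close>

lemma rel_lipschitz_mono:
  assumes "convex Q" "prox_function Q h gh" "rel_lipschitz Q h gh M f gf" "M \<le> M'"
  shows "rel_lipschitz Q h gh M' f gf"
proof -
  have "M * sqrt (2 * bregman h gh y x) \<le> M' * sqrt (2 * bregman h gh y x)"
    if "x \<in> Q" "y \<in> Q" for x y
    using bregman_nonneg[OF assms(1,2) that] assms(4) by (intro mult_right_mono) auto
  then show ?thesis
    using assms(3,4) unfolding rel_lipschitz_def by (smt (verit, best))
qed

text \<open>The Lipschitz property lets \<open>d\<close> drop by at most
  \<open>M * sqrt (2 * V)\<close> from \<open>z\<close> to \<open>x\<close>, and strong convexity
  gives back \<open>V\<close>; the difference is largest at \<open>sqrt (2 * V) = M\<close>.\<close>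

lemma rel_lipschitz_strongly_convex_osc:
  assumes Q: "convex Q" and h: "prox_function Q h gh"
    and lip: "rel_lipschitz Q h gh M d gd" and sc: "rel_strongly_convex Q h gh 1 d gd"
    and "x \<in> Q" "z \<in> Q"
  shows "d z - d x \<le> M\<^sup>2 / 2"
proof -
  define V where "V = bregman h gh x z"
  have "0 \<le> V"
    unfolding V_def using bregman_nonneg[OF Q h] assms(5,6) by blast
  then have "(sqrt (2 * V))\<^sup>2 = 2 * V"
    by simp
  moreover have "0 \<le> (M - sqrt (2 * V))\<^sup>2"
    by simp
  ultimately have "M * sqrt (2 * V) - V \<le> M\<^sup>2 / 2"
    by (simp add: power2_diff)
  moreover have "d x \<ge> d z + gd z \<bullet> (x - z) + V" "gd z \<bullet> (x - z) + M * sqrt (2 * V) \<ge> 0"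
    using sc lip assms(5,6) by (auto simp: rel_strongly_convex_def rel_lipschitz_def V_def)
  ultimately show ?thesis
    by linarith
qed

text \<open>Split \<open>x - z\<close> at \<open>x'\<close>. The Lipschitz properties bound the part
  up to \<open>x'\<close> by \<open>K * sqrt (2 * V)\<close>, which the term \<open>- S * V\<close>
  from the optimality of \<open>x'\<close> absorbs at cost \<open>K\<^sup>2 / (2 * S)\<close>.
  Strong convexity of \<open>\<phi>\<close> and of \<open>lam\<close> times \<open>d\<close> lowers
  the weight of the divergence at \<open>x\<close> to \<open>S - \<mu> - lam\<close>, the
  \<open>S\<close> of the preceding step.\<close>

lemma regularized_mirror_step:
  assumes Q: "convex Q" and h: "prox_function Q h gh"
    and \<phi>: "rel_lipschitz Q h gh M \<phi> g\<phi>" "rel_strongly_convex Q h gh \<mu> \<phi> g\<phi>"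
    and d: "rel_lipschitz Q h gh Md d gd" "rel_strongly_convex Q h gh 1 d gd"
    and "0 \<le> lam" "0 < S"
    and min: "is_arg_min (\<lambda>y. 1 / S * ((g\<phi> x + lam *\<^sub>R gd x) \<bullet> y) + bregman h gh y x)
                (\<lambda>y. y \<in> Q) x'"
    and x: "x \<in> Q" and z: "z \<in> Q"
  shows "\<phi> x - \<phi> z \<le> lam * (d z - d x)
           + ((S - \<mu> - lam) * bregman h gh z x - S * bregman h gh z x')
           + (M + lam * Md)\<^sup>2 / (2 * S)"
proof -
  define V where "V = bregman h gh x' x"
  define K where "K = M + lam * Md"
  let ?p = "g\<phi> x + lam *\<^sub>R gd x"
  have x': "x' \<in> Q"
    using min by (simp add: is_arg_min_def)
  have "0 \<le> V"
    unfolding V_def using bregman_nonneg[OF Q h x x'] .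
  then have "(sqrt (2 * V))\<^sup>2 = 2 * V"
    by simp
  \<comment> \<open>Completing the square in \<open>sqrt (2 * V)\<close>; the division by
    \<open>2 * S\<close> comes afterwards.\<close>
  moreover have "0 \<le> (K - S * sqrt (2 * V))\<^sup>2"
    by simp
  ultimately have "K * sqrt (2 * V) - S * V \<le> K\<^sup>2 / (2 * S)"
    using \<open>0 < S\<close> by (simp add: power2_diff power_mult_distrib field_simps power2_eq_square)
  moreover have "?p \<bullet> (x - x') \<le> K * sqrt (2 * V)"
  proof -
    have "g\<phi> x \<bullet> (x' - x) + M * sqrt (2 * V) \<ge> 0" and gd: "gd x \<bullet> (x' - x) + Md * sqrt (2 * V) \<ge> 0"
      using \<phi>(1) d(1) x x' by (auto simp: rel_lipschitz_def V_def)
    moreover have "lam * (gd x \<bullet> (x' - x) + Md * sqrt (2 * V)) \<ge> 0"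
      using gd \<open>0 \<le> lam\<close> by (rule mult_nonneg_nonneg[rotated])
    ultimately show ?thesis
      by (simp add: K_def algebra_simps)
  qed
  moreover have "?p \<bullet> (x' - z) \<le> S * bregman h gh z x - S * bregman h gh z x' - S * V"
    using mirror_step_optimality[OF Q h min z] \<open>0 < S\<close>
    by (simp add: field_simps V_def)
  moreover have "?p \<bullet> (x - z) = ?p \<bullet> (x - x') + ?p \<bullet> (x' - z)"
    by (simp add: inner_diff_right)
  ultimately have "?p \<bullet> (x - z) \<le> S * bregman h gh z x - S * bregman h gh z x' + K\<^sup>2 / (2 * S)"
    by linarith
  moreover have "\<phi> x - \<phi> z \<le> g\<phi> x \<bullet> (x - z) - \<mu> * bregman h gh z x"
    using \<phi>(2) x z by (force simp: rel_strongly_convex_def inner_diff_right)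
  moreover have "lam * (d x - d z) \<le> lam * (gd x \<bullet> (x - z) - bregman h gh z x)"
    using d(2) x z \<open>0 \<le> lam\<close> by (intro mult_left_mono) (force simp: rel_strongly_convex_def inner_diff_right)+
  ultimately show ?thesis
    by (simp add: K_def algebra_simps)
qed

text \<open>Here \<open>l\<close> are the weights of the algorithm, \<open>k\<close> those of a
  competitor, and \<open>C\<close> is the constant value of \<open>lam t * S t\<close>. In 3/4, the
  part 1/4 pays for the oscillation of \<open>d\<close> and 1/2 for the square of
  \<open>M\<close>.\<close>

lemma adaptive_weights_competitive:
  fixes l k m :: "nat \<Rightarrow> real"
  assumes l: "\<forall>t\<in>{1..n}. 0 < l t" and m: "\<forall>t\<in>{1..n}. 0 \<le> m t"
    and C: "\<forall>t\<in>{1..n}. l t * ((\<Sum>s=1..t. m s) + (\<Sum>s=1..t. l s)) = C"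
    and k: "\<forall>t\<in>{1..n}. 0 \<le> k t \<and> 0 < (\<Sum>s=1..t. m s) + (\<Sum>s=1..t. k s)"
  shows "(\<Sum>t=1..n. l t * (3/4 + l t / (2 * ((\<Sum>s=1..t. m s) + (\<Sum>s=1..t. l s)))))
           \<le> (\<Sum>t=1..n. 2 * k t + C / ((\<Sum>s=1..t. m s) + (\<Sum>s=1..t. k s)))"
  using assms
proof (induction n)
  case 0
  then show ?case
    by simp
next
  case (Suc n)
  define S where "S = (\<lambda>t. (\<Sum>s=1..t. m s) + (\<Sum>s=1..t. l s))"
  define U where "U = (\<lambda>t. (\<Sum>s=1..t. m s) + (\<Sum>s=1..t. k s))"
  define a where "a = (\<lambda>t. l t * (3/4 + l t / (2 * S t)))"
  define b where "b = (\<lambda>t. 2 * k t + C / U t)"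
  have l: "0 < l t" and m: "0 \<le> m t" and k: "0 \<le> k t" and U: "0 < U t" and C: "l t * S t = C"
    if "t \<in> {1..Suc n}" for t
    using Suc.prems that by (auto simp: S_def U_def)
  have l_le_S: "l t \<le> S t" if "t \<in> {1..Suc n}" for t
  proof -
    have "l t \<le> (\<Sum>s=1..t. l s)"
      using that l by (intro member_le_sum) (auto simp: less_imp_le)
    moreover have "0 \<le> (\<Sum>s=1..t. m s)"
      using that m by (intro sum_nonneg) auto
    ultimately show ?thesis
      by (simp add: S_def)
  qed
  have C_pos: "0 < C"
    using l[of 1] l_le_S[of 1] C[of 1] by (metis One_nat_def Suc_le_mono atLeastAtMost_iff le0 le_refl less_le_trans mult_pos_pos)
  have IH: "sum a {1..n} \<le> sum b {1..n}"
    unfolding a_def b_def S_def U_def using Suc.prems by (intro Suc.IH) auto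
  have "sum a {1..Suc n} \<le> sum b {1..Suc n}"
  proof (cases "(\<Sum>s=1..Suc n. l s) \<le> (\<Sum>s=1..Suc n. k s)")
    case True
    \<comment> \<open>As \<open>l t \<le> S t\<close>, each cost is at most 5/4 of
      \<open>l t\<close>. The full sums are compared directly, without the induction
      hypothesis.\<close>
    have "sum a {1..Suc n} \<le> (\<Sum>s=1..Suc n. 2 * l s)"
    proof (rule sum_mono)
      fix t assume t: "t \<in> {1..Suc n}"
      have "l t / (2 * S t) \<le> 1 / 2"
        using l_le_S[OF t] l[OF t] by (simp add: field_simps)
      then show "a t \<le> 2 * l t"
        unfolding a_def using l[OF t] by (simp add: mult.commute)
    qed
    also have "\<dots> \<le> (\<Sum>s=1..Suc n. 2 * k s)"
      using True by (simp only: flip: sum_distrib_left)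
    also have "\<dots> \<le> sum b {1..Suc n}"
      using C_pos U by (intro sum_mono) (auto simp: b_def less_imp_le)
    finally show ?thesis .
  next
    case False
    then have US: "U (Suc n) < S (Suc n)"
      by (simp add: U_def S_def)
    let ?t = "Suc n"
    have t: "?t \<in> {1..Suc n}"
      by simp
    have S_pos: "0 < S ?t"
      using l[OF t] l_le_S[OF t] by linarith
    \<comment> \<open>Only the first step can have \<open>l t > S t / 2\<close>: the products \<open>l t * S t\<close> are
      constant and \<open>S\<close> increases, so \<open>l\<close> decreases.\<close>
    have "a ?t \<le> b ?t"
    proof (cases "n = 0")
      case True
      have eq: "S ?t - U ?t = l ?t - k ?t"
        using True by (simp add: S_def U_def)
      \<comment> \<open>This is \<open>S / U + U / S \<ge> 2\<close>. As
        \<open>2 - U / S = 1 + (l - k) / S\<close>, it yields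
        \<open>l + l\<^sup>2 / S \<le> C / U + l * k / S\<close>, and the last term is at most
        \<open>k\<close>.\<close>
      have "2 - U ?t / S ?t \<le> S ?t / U ?t"
        using S_pos U[OF t] zero_le_power2[of "S ?t - U ?t"]
        by (simp add: field_simps power2_eq_square)
      then have "l ?t * (2 - U ?t / S ?t) \<le> l ?t * (S ?t / U ?t)"
        using l[OF t] by (intro mult_left_mono) auto
      also have "\<dots> = C / U ?t"
        using C[OF t] by simp
      finally have "l ?t * (1 + (l ?t - k ?t) / S ?t) \<le> C / U ?t"
        using S_pos by (simp add: diff_divide_distrib flip: eq)
      moreover have "l ?t * (k ?t / S ?t) \<le> k ?t"
        using k[OF t] l_le_S[OF t] S_pos mult_right_mono[of "l ?t" "S ?t" "k ?t"]
        by (simp add: field_simps)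
      moreover have "0 \<le> l ?t * (l ?t / S ?t)"
        using l[OF t] S_pos by simp
      ultimately show ?thesis
        using k[OF t] l[OF t] unfolding a_def b_def
        by (simp add: algebra_simps diff_divide_distrib)
    next
      case False
      then have n: "n \<in> {1..Suc n}"
        by simp
      have step: "S ?t = S n + m ?t + l ?t"
        by (simp add: S_def)
      have "l ?t * S ?t = l n * S n"
        using C[OF t] C[OF n] by simp
      also have "\<dots> \<le> l n * S ?t"
        using l[OF n] l[OF t] m[OF t] step by (intro mult_left_mono) auto
      finally have "l ?t \<le> l n"
        using S_pos by simp
      \<comment> \<open>\<open>S ?t\<close> is at least \<open>S n + l ?t\<close>, and
        \<open>S n \<ge> l n \<ge> l ?t\<close>.\<close>
      then have "2 * l ?t \<le> S ?t"
        using l_le_S[OF n] m[OF t] step by linarith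
      then have "l ?t / (2 * S ?t) \<le> 1 / 4"
        using S_pos by (simp add: field_simps)
      \<comment> \<open>The coefficients add up to exactly \<open>3/4 + 1/4 = 1\<close>, so the last
        cost is at most \<open>l ?t = C / S ?t\<close>.\<close>
      then have "a ?t \<le> l ?t * 1"
        unfolding a_def using l[OF t] by (intro mult_left_mono) auto
      also have "\<dots> = C / S ?t"
        using C[OF t] S_pos by (simp add: field_simps)
      also have "\<dots> \<le> C / U ?t"
        using US U[OF t] C_pos S_pos by (intro divide_left_mono) auto
      finally show ?thesis
        using k[OF t] by (simp add: b_def)
    qed
    then show ?thesis
      using IH by simp
  qed
  then show ?case
    by (simp only: a_def b_def S_def U_def)
qed

text \<open>Attainment makes the \<open>INF\<close> in \<open>regret\<close> a genuine minimum, so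
  that it can be replaced by the value at \<open>xstar\<close>.\<close>

lemma is_arg_min_imp_INF_eq:
  fixes F :: "'a \<Rightarrow> real"
  assumes "is_arg_min F P z"
  shows "(INF y\<in>{y. P y}. F y) = F z"
  using assms by (intro cInf_eq_minimum) (auto simp: is_arg_min_def not_less)

theorem theorem5:
  fixes Q :: "(real ^ 'n) set"
    and h g d :: "real ^ 'n \<Rightarrow> real"
    and f :: "nat \<Rightarrow> real ^ 'n \<Rightarrow> real"
    and gh gg gd :: "real ^ 'n \<Rightarrow> real ^ 'n"
    and gf :: "nat \<Rightarrow> real ^ 'n \<Rightarrow> real ^ 'n"
    and Mf \<mu>f \<mu> lam \<eta> :: "nat \<Rightarrow> real"
    and Mg \<mu>g Md M A2 \<epsilon> :: real
    and T TJ :: nat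
    and I J :: "nat set"
    and x p :: "nat \<Rightarrow> real ^ 'n"
    and xstar :: "real ^ 'n"
  assumes Q: "closed Q" "convex Q"
    and h: "prox_function Q h gh"
    and T: "T \<ge> 1"
    and eps: "\<epsilon> > 0"
    and I_def: "I = {t \<in> {1..T + TJ}. g (x t) \<le> \<epsilon>}"
    and J_def: "J = {t \<in> {1..T + TJ}. \<not> g (x t) \<le> \<epsilon>}"
    and card_I: "card I = T"
    and card_J: "card J = TJ"
    and stop: "\<forall>n < T + TJ. card {t \<in> {1..n}. g (x t) \<le> \<epsilon>} < T"
    and f_lip: "\<forall>t\<in>I. rel_lipschitz Q h gh (Mf t) (f t) (gf t)"
    and f_sc: "\<forall>t\<in>I. rel_strongly_convex Q h gh (\<mu>f t) (f t) (gf t)"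
    and g_lip: "rel_lipschitz Q h gh Mg g gg"
    and g_sc: "rel_strongly_convex Q h gh \<mu>g g gg"
    and d_lip: "rel_lipschitz Q h gh Md d gd"
    and d_sc: "rel_strongly_convex Q h gh 1 d gd"
    and d_nonneg: "\<forall>z\<in>Q. d z \<ge> 0"
    and d_bdd: "bdd_above (d ` Q)"
    and A2_def: "A2 = (SUP z\<in>Q. d z)"
    and M_def: "M = Max (insert Mg (Mf ` I))"
    and mu_def: "\<forall>t\<in>{1..T + TJ}. \<mu> t = (if t \<in> I then \<mu>f t else \<mu>g)"
    and mu_nonneg: "\<forall>t\<in>{1..T + TJ}. \<mu> t \<ge> 0"
    and lam_def: "\<forall>t\<in>{1..T + TJ}. lam t =
        (sqrt (((\<Sum>s=1..t. \<mu> s) + (\<Sum>s=1..<t. lam s))\<^sup>2 + 8 * M\<^sup>2 / (A2 + 2 * Md\<^sup>2))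
          - ((\<Sum>s=1..t. \<mu> s) + (\<Sum>s=1..<t. lam s))) / 2"
    and eta_def: "\<forall>t\<in>{1..T + TJ}. \<eta> t = 1 / ((\<Sum>s=1..t. \<mu> s) + (\<Sum>s=1..t. lam s))"
    and p_def: "\<forall>t\<in>{1..T + TJ}. p t =
        (if t \<in> I then gf t (x t) else gg (x t)) + lam t *\<^sub>R gd (x t)"
    and x1: "x 1 \<in> Q"
    and step: "\<forall>t\<in>{1..T + TJ}.
        is_arg_min (\<lambda>z. \<eta> t * (p t \<bullet> z) + bregman h gh z (x t)) (\<lambda>z. z \<in> Q) (x (t + 1))"
    and xstar: "is_arg_min (\<lambda>z. \<Sum>t\<in>I. f t z) (\<lambda>z. z \<in> Q \<and> g z \<le> 0) xstar"
    and regret_nonneg: "regret Q g f I x \<ge> 0"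
  shows "regret Q g f I x
           \<le> (\<Sum>t=1..T + TJ. lam t) * A2
             + (\<Sum>t=1..T + TJ. (M + lam t * Md)\<^sup>2 / ((\<Sum>s=1..t. \<mu> s) + (\<Sum>s=1..t. lam s)))
             - \<epsilon> * real TJ
       \<and> regret Q g f I x
           \<le> 2 * (INF l\<in>{l :: nat \<Rightarrow> real. \<forall>t\<in>{1..T + TJ}.
                        l t \<ge> 0 \<and> (\<Sum>s=1..t. \<mu> s) + (\<Sum>s=1..t. l s) > 0}.
                  (A2 + 2 * Md\<^sup>2) * (\<Sum>t=1..T + TJ. l t)
                  + (\<Sum>t=1..T + TJ. (M + l t * Md)\<^sup>2 / ((\<Sum>s=1..t. \<mu> s) + (\<Sum>s=1..t. l s))))
             - \<epsilon> * real TJ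
       \<and> (\<forall>t\<in>I. g (x t) \<le> \<epsilon>)"
proof -

  \<comment> \<open>Constants and a common notation for both kinds of step\<close>
  define N where "N = T + TJ"
  define S where "S = (\<lambda>t. (\<Sum>s=1..t. \<mu> s) + (\<Sum>s=1..t. lam s))"
  define B where "B = A2 + 2 * Md\<^sup>2"
  define \<phi> where "\<phi> = (\<lambda>t. if t \<in> I then f t else g)"
  define g\<phi> where "g\<phi> = (\<lambda>t. if t \<in> I then gf t else gg)"
  define V where "V = (\<lambda>t. bregman h gh xstar (x t))"
  have Md: "0 < Md"
    using d_lip by (simp add: rel_lipschitz_def)
  have fin: "finite I" "finite J" and I_sub: "I \<subseteq> {1..N}"
    by (auto simp: I_def J_def N_def)
  have M_ge: "Mg \<le> M" "\<And>t. t \<in> I \<Longrightarrow> Mf t \<le> M"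
    using fin by (auto simp: M_def)
  have M: "0 < M"
    using g_lip M_ge(1) by (simp add: rel_lipschitz_def)
  have d_le: "d z \<le> A2" if "z \<in> Q" for z
    unfolding A2_def using that d_bdd by (rule cSUP_upper)
  have A2: "0 \<le> A2"
    using d_le[OF x1] d_nonneg x1 by force
  have B: "0 < B" "2 * Md\<^sup>2 \<le> B"
    using A2 Md by (auto simp: B_def intro!: add_nonneg_pos)

  \<comment> \<open>The regularization weights\<close>
  have lam: "0 < lam t" "lam t * S t = 2 * M\<^sup>2 / B" if t: "t \<in> {1..N}" for t
  proof -
    \<comment> \<open>With \<open>S t = a + lam t\<close>, the rule makes \<open>lam t\<close> the
      positive root of \<open>X\<^sup>2 + a * X = 2 * M\<^sup>2 / B\<close>.\<close>
    define a where "a = (\<Sum>s=1..t. \<mu> s) + (\<Sum>s=1..<t. lam s)"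
    define c where "c = 8 * M\<^sup>2 / B"
    have c: "0 < c"
      using M B by (simp add: c_def)
    define r where "r = sqrt (a\<^sup>2 + c)"
    have eq: "lam t = (r - a) / 2"
      using lam_def t by (simp add: a_def c_def B_def N_def r_def)
    have "\<bar>a\<bar> < r"
      using c real_sqrt_less_mono[of "a\<^sup>2" "a\<^sup>2 + c"] by (simp add: r_def)
    then show "0 < lam t"
      using eq by simp
    have "{1..t} = insert t {1..<t}"
      using t by auto
    then have S_eq: "S t = (r + a) / 2"
      using eq by (simp add: S_def a_def field_simps)
    have "lam t * S t = (r\<^sup>2 - a\<^sup>2) / 4"
      unfolding eq S_eq by (simp add: power2_eq_square algebra_simps)
    also have "\<dots> = 2 * M\<^sup>2 / B"
      using c by (simp add: c_def r_def)
    finally show "lam t * S t = 2 * M\<^sup>2 / B" .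
  qed
  have S_pos: "0 < S t" if "t \<in> {1..N}" for t
  proof -
    have "0 < lam t * S t"
      using lam(2)[OF that] M B by simp
    then show ?thesis
      using lam(1)[OF that] by (simp add: zero_less_mult_iff)
  qed
  have lam_le_S: "lam t \<le> S t" if "t \<in> {1..N}" for t
  proof -
    have "lam t \<le> (\<Sum>s=1..t. lam s)"
      using that lam(1) by (intro member_le_sum) (auto simp: less_imp_le)
    moreover have "0 \<le> (\<Sum>s=1..t. \<mu> s)"
      using that mu_nonneg by (intro sum_nonneg) (auto simp: N_def)
    ultimately show ?thesis
      by (simp add: S_def)
  qed

  \<comment> \<open>Feasibility of the iterates and the regret at \<open>xstar\<close>\<close>
  have next_Q: "x (t + 1) \<in> Q" if "t \<in> {1..N}" for t
    using bspec[OF step, of t] that by (simp add: is_arg_min_def N_def)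
  have xQ: "x t \<in> Q" if "t \<in> {1..N}" for t
  proof (cases "t = 1")
    case False
    then have "t - 1 \<in> {1..N}"
      using that by auto
    then show ?thesis
      using next_Q[of "t - 1"] that by simp
  qed (use x1 in simp)
  have xs: "xstar \<in> Q" "g xstar \<le> 0"
    using xstar by (auto simp: is_arg_min_def)
  have regret_eq: "regret Q g f I x = (\<Sum>t\<in>I. f t (x t) - f t xstar)"
    using is_arg_min_imp_INF_eq[OF xstar] by (simp add: regret_def sum_subtractf)

  \<comment> \<open>The inequality for one step and its sum\<close>
  have step_le: "\<phi> t (x t) - \<phi> t xstar \<le> lam t * (d xstar - d (x t))
      + (M + lam t * Md)\<^sup>2 / (2 * S t) + (S (t - 1) * V t - S t * V (t + 1))"
    if t: "t \<in> {1..N}" for t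
  proof -
    have "rel_lipschitz Q h gh M (\<phi> t) (g\<phi> t)"
      using f_lip g_lip M_ge by (auto simp: \<phi>_def g\<phi>_def intro: rel_lipschitz_mono[OF Q(2) h])
    moreover have "rel_strongly_convex Q h gh (\<mu> t) (\<phi> t) (g\<phi> t)"
      using f_sc g_sc mu_def t by (auto simp: \<phi>_def g\<phi>_def N_def)
    moreover have "is_arg_min (\<lambda>y. 1 / S t * ((g\<phi> t (x t) + lam t *\<^sub>R gd (x t)) \<bullet> y)
        + bregman h gh y (x t)) (\<lambda>y. y \<in> Q) (x (t + 1))"
    proof -
      have "\<eta> t = 1 / S t" "p t = g\<phi> t (x t) + lam t *\<^sub>R gd (x t)"
        using eta_def p_def t by (auto simp: S_def g\<phi>_def N_def)
      then show ?thesis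
        using bspec[OF step, of t] t by (simp only: N_def)
    qed
    moreover have "S t - \<mu> t - lam t = S (t - 1)"
      using t by (cases t) (auto simp: S_def)
    ultimately show ?thesis
      using regularized_mirror_step[OF Q(2) h _ _ d_lip d_sc less_imp_le[OF lam(1)[OF t]] S_pos[OF t]
          _ xQ[OF t] xs(1), of M "\<phi> t" "g\<phi> t" "\<mu> t" "x (t + 1)"]
      by (simp add: V_def)
  qed
  \<comment> \<open>\<open>S 0 = 0\<close>, so the divergence at \<open>x 1\<close> has weight zero
    and no bound on it enters.\<close>
  have telescope: "(\<Sum>t=1..n. S (t - 1) * V t - S t * V (t + 1)) = - (S n * V (n + 1))" for n
    by (induction n) (auto simp: S_def)
  have N: "N \<in> {1..N}"
    using T by (simp add: N_def)
  have V_last: "0 \<le> V (N + 1)"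
    unfolding V_def using bregman_nonneg[OF Q(2) h next_Q[OF N] xs(1)] .
  \<comment> \<open>Every non-productive step contributes more than \<open>\<epsilon>\<close>,
    because \<open>g (x t) > \<epsilon>\<close> and \<open>g xstar \<le> 0\<close>.\<close>
  have "regret Q g f I x + \<epsilon> * real TJ \<le> (\<Sum>t=1..N. \<phi> t (x t) - \<phi> t xstar)"
  proof -
    have split: "{1..N} = I \<union> J" "I \<inter> J = {}"
      by (auto simp: I_def J_def N_def)
    have "\<epsilon> * real TJ = (\<Sum>t\<in>J. \<epsilon>)"
      by (simp add: card_J)
    also have "\<dots> \<le> (\<Sum>t\<in>J. g (x t) - g xstar)"
      using xs(2) by (intro sum_mono) (auto simp: J_def)
    also have "\<dots> = (\<Sum>t\<in>J. \<phi> t (x t) - \<phi> t xstar)"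
      using split by (intro sum.cong) (auto simp: \<phi>_def)
    finally show ?thesis
      unfolding regret_eq split(1) sum.union_disjoint[OF fin split(2)] by (simp add: \<phi>_def)
  qed
  also have "\<dots> \<le> (\<Sum>t=1..N. lam t * (d xstar - d (x t)) + (M + lam t * Md)\<^sup>2 / (2 * S t)
      + (S (t - 1) * V t - S t * V (t + 1)))"
    by (intro sum_mono step_le)
  also have "\<dots> \<le> (\<Sum>t=1..N. lam t * (d xstar - d (x t)) + (M + lam t * Md)\<^sup>2 / (2 * S t))"
    unfolding sum.distrib telescope using V_last S_pos[OF N] by simp
  finally have main: "regret Q g f I x + \<epsilon> * real TJ
      \<le> (\<Sum>t=1..N. lam t * (d xstar - d (x t)) + (M + lam t * Md)\<^sup>2 / (2 * S t))" .

  \<comment> \<open>The bound in terms of \<open>A2\<close>\<close>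
  have bound1: "regret Q g f I x + \<epsilon> * real TJ
      \<le> (\<Sum>t=1..N. lam t) * A2 + (\<Sum>t=1..N. (M + lam t * Md)\<^sup>2 / S t)"
  proof -
    have "lam t * (d xstar - d (x t)) + (M + lam t * Md)\<^sup>2 / (2 * S t)
        \<le> lam t * A2 + (M + lam t * Md)\<^sup>2 / S t" if t: "t \<in> {1..N}" for t
    proof (rule add_mono)
      show "lam t * (d xstar - d (x t)) \<le> lam t * A2"
        using lam(1)[OF t] d_le[OF xs(1)] d_nonneg xQ[OF t] by (intro mult_left_mono) force+
      show "(M + lam t * Md)\<^sup>2 / (2 * S t) \<le> (M + lam t * Md)\<^sup>2 / S t"
        using S_pos[OF t] by (intro divide_left_mono) auto
    qed
    from order.trans[OF main sum_mono, OF this] show ?thesis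
      by (simp add: sum.distrib sum_distrib_right)
  qed

  \<comment> \<open>The bound in terms of \<open>B\<close> and the weights\<close>
  have bound2: "regret Q g f I x + \<epsilon> * real TJ
      \<le> B * (\<Sum>t=1..N. lam t * (3/4 + lam t / (2 * S t)))"
  proof -
    have "lam t * (d xstar - d (x t)) + (M + lam t * Md)\<^sup>2 / (2 * S t)
        \<le> B * (lam t * (3/4 + lam t / (2 * S t)))" if t: "t \<in> {1..N}" for t
    proof -
      \<comment> \<open>The oscillation \<open>Md\<^sup>2 / 2\<close> is at most
        \<open>B / 4\<close>.\<close>
      have "lam t * (d xstar - d (x t)) \<le> lam t * (B / 4)"
        using rel_lipschitz_strongly_convex_osc[OF Q(2) h d_lip d_sc xQ[OF t] xs(1)] B lam(1)[OF t]
        by (intro mult_left_mono) auto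
      moreover have "(M + lam t * Md)\<^sup>2 / (2 * S t) \<le> B * (lam t * (1/2 + lam t / (2 * S t)))"
      proof -
        \<comment> \<open>After \<open>(u + v)\<^sup>2 \<le> 2 * u\<^sup>2 + 2 * v\<^sup>2\<close>,
          the rule for the weights turns \<open>2 * M\<^sup>2\<close> into
          \<open>B * (lam t * S t)\<close>.\<close>
        have "(M + lam t * Md)\<^sup>2 \<le> 2 * M\<^sup>2 + (lam t)\<^sup>2 * (2 * Md\<^sup>2)"
          using zero_le_power2[of "M - lam t * Md"]
          by (simp add: power2_diff power2_sum power_mult_distrib mult.commute)
        also have "\<dots> \<le> B * (lam t * S t) + (lam t)\<^sup>2 * B"
          using B by (intro add_mono mult_left_mono) (auto simp: lam(2)[OF t])
        also have "\<dots> = B * (lam t * (1/2 + lam t / (2 * S t))) * (2 * S t)"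
          using S_pos[OF t] by (simp add: field_simps power2_eq_square)
        finally show ?thesis
          using S_pos[OF t] by (simp add: pos_divide_le_eq)
      qed
      ultimately show ?thesis
        by (simp add: algebra_simps)
    qed
    from order.trans[OF main sum_mono, OF this] show ?thesis
      by (simp add: sum_distrib_left)
  qed

  \<comment> \<open>Comparison with all admissible weights\<close>
  let ?L = "{l :: nat \<Rightarrow> real. \<forall>t\<in>{1..N}. l t \<ge> 0 \<and> (\<Sum>s=1..t. \<mu> s) + (\<Sum>s=1..t. l s) > 0}"
  let ?H = "\<lambda>l :: nat \<Rightarrow> real. B * (\<Sum>t=1..N. l t)
      + (\<Sum>t=1..N. (M + l t * Md)\<^sup>2 / ((\<Sum>s=1..t. \<mu> s) + (\<Sum>s=1..t. l s)))"
  have competitive: "(regret Q g f I x + \<epsilon> * real TJ) / 2 \<le> ?H l" if l: "l \<in> ?L" for l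
  proof -
    define U where "U = (\<lambda>t. (\<Sum>s=1..t. \<mu> s) + (\<Sum>s=1..t. l s))"
    have "(\<Sum>t=1..N. lam t * (3/4 + lam t / (2 * S t))) \<le> (\<Sum>t=1..N. 2 * l t + 2 * M\<^sup>2 / B / U t)"
      unfolding S_def U_def using l lam mu_nonneg
      by (intro adaptive_weights_competitive) (auto simp: S_def N_def)
    then have "B * (\<Sum>t=1..N. lam t * (3/4 + lam t / (2 * S t)))
        \<le> B * (\<Sum>t=1..N. 2 * l t + 2 * M\<^sup>2 / B / U t)"
      using B by (intro mult_left_mono) auto
    \<comment> \<open>The factor 2 of the second bound: \<open>B\<close> cancels in
      \<open>2 * M\<^sup>2 / B\<close>, and both sums carry the same 2.\<close>
    also have "\<dots> = 2 * (B * (\<Sum>t=1..N. l t) + (\<Sum>t=1..N. M\<^sup>2 / U t))"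
      using B by (simp add: sum.distrib sum_distrib_left algebra_simps)
    \<comment> \<open>The comparison yields only \<open>M\<^sup>2\<close> in the numerators; adding
      \<open>l t * Md \<ge> 0\<close> to \<open>M\<close> enlarges them.\<close>
    also have "\<dots> \<le> 2 * (B * (\<Sum>t=1..N. l t) + (\<Sum>t=1..N. (M + l t * Md)\<^sup>2 / U t))"
    proof -
      have "M\<^sup>2 / U t \<le> (M + l t * Md)\<^sup>2 / U t" if "t \<in> {1..N}" for t
        using l that M Md by (intro divide_right_mono power_mono) (auto simp: U_def less_imp_le)
      then have "(\<Sum>t=1..N. M\<^sup>2 / U t) \<le> (\<Sum>t=1..N. (M + l t * Md)\<^sup>2 / U t)"
        by (rule sum_mono)
      then show ?thesis
        by simp
    qed
    finally show ?thesis
      using bound2 by (simp add: U_def)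
  qed
  \<comment> \<open>The weights of the algorithm are admissible, so the infimum ranges over a
    nonempty set and a common lower bound of the values is below it.\<close>
  have "lam \<in> ?L"
    using lam(1) S_pos by (auto simp: S_def less_imp_le)
  then have "?L \<noteq> {}"
    by blast
  define m where "m = (INF l\<in>?L. ?H l)"
  have "(regret Q g f I x + \<epsilon> * real TJ) / 2 \<le> m"
    unfolding m_def using \<open>?L \<noteq> {}\<close> competitive by (rule cINF_greatest)
  then have "regret Q g f I x \<le> 2 * m - \<epsilon> * real TJ"
    by (simp add: field_simps)
  moreover have "regret Q g f I x \<le> (\<Sum>t=1..N. lam t) * A2
      + (\<Sum>t=1..N. (M + lam t * Md)\<^sup>2 / S t) - \<epsilon> * real TJ"
    using bound1 by linarith
  moreover have "\<forall>t\<in>I. g (x t) \<le> \<epsilon>"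
    by (simp add: I_def)
  ultimately show ?thesis
    unfolding m_def S_def B_def N_def by blast
qed

end
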